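(* Let $m,n\ge 1$, let $S\subseteq[m]\times[n]$, and let $X\subseteq\mathbb{R}^S$ be the set of $m\times n$ positive partial matrices $M=(m_{ij})_{(i,j)\in S}$ subordinate to the pattern $S$ that can be completed to a rank-one matrix in $\Delta^{mn-1}$. Let $s$ be the number of connected components of $G(S)$ that contain at least one edge, let $K_1,\dots,K_s$ be the corresponding blocks of the transitive closure $\overline{G(S)}$, and for $l=1,\dots,s$ let $b_l$ be the sum of the weights of the edges in $K_l$, where the weights of edges of $\overline{G(S)}$ not in $G(S)$ are defined by the cycle-completion formula given in the context. (1) If $\overline{G(S)}=K_{m,n}$, then $X$ is the set of $M\in\mathbb{R}^S$ satisfying: the cycle relation of every cycle of $G(S)$; $b_1=1$; and $m_{ij}>0$ for all $(i,j)\in S$. (2) Otherwise, $X$ is the set of $M\in\mathbb{R}^S$ satisfying: the cycle relation of every cycle of $G(S)$; $m_{ij}>0$ for all $(i,j)\in S$; and $\sum_{l=1}^s\sqrt{b_l}\le 1$.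
   Context: $[m]=\{1,\dots,m\}$. A partial matrix subordinate to a pattern $S\subseteq[m]\times[n]$ is an $m\times n$ matrix in which exactly the entries in positions $S$ are specified, i.e. a point of $\mathbb{R}^S$; it is positive if all specified entries are positive. $\Delta^{mn-1}$ is the standard simplex of real $m\times n$ matrices with nonnegative entries summing to one. A completion fills in the unspecified entries. $G(S)$ is the bipartite graph with vertices $r_1,\dots,r_m$ (rows) and $c_1,\dots,c_n$ (columns) and an edge $r_ic_j$ for each $(i,j)\in S$; given $M$, the edge $r_ic_j$ has weight $m_{ij}$. The transitive closure $\overline{G(S)}$ is obtained from $G(S)$ by replacing each connected component by the complete bipartite graph on the (row and column) vertices of that component; these are its blocks. $K_{m,n}$ is the complete bipartite graph on all row and column vertices. Cycle relation: for a cycle $\{(r_1,c_1),(r_1,c_2),(r_2,c_2),\dots,(r_k,c_k),(r_k,c_1)\}$ in $G(S)$ (with $k\ge2$, here $r_1,\dots,r_k$ denote distinct rows and $c_1,\dots,c_k$ distinct columns) the relation is $m_{r_1c_1}m_{r_2c_2}\cdots m_{r_kc_k}=m_{r_1c_2}m_{r_2c_3}\cdots m_{r_{k-1}c_k}m_{r_kc_1}$. Cycle-completion formula: for an edge $(i,j)$ of $\overline{G(S)}$ with $(i,j)\notin S$, choose a cycle $\{(r_1,c_1),(r_1,c_2),(r_2,c_2),\dots,(r_k,c_k),(r_k,c_1)\}$ in $G(S\cup\{(i,j)\})$ with $(r_1,c_1)=(i,j)$ and set $m_{ij}=\dfrac{m_{r_1c_2}m_{r_2c_3}\cdots m_{r_kc_1}}{m_{r_2c_2}m_{r_3c_3}\cdots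 m_{r_kc_k}}$. (For positive $M$ satisfying all cycle relations this does not depend on the chosen cycle.) *)

theory Defs
  imports "HOL-Analysis.Analysis"
begin

text \<open>
  The index sets of rows and columns are arbitrary finite types \<^typ>\<open>'m\<close> and \<^typ>\<open>'n\<close> (of
  cardinality m and n; types are nonempty, so m and n are at least 1). A pattern is a set
  of positions, and a point of the space of partial matrices with pattern S is a function
  on positions that is \<^const>\<open>undefined\<close> outside S.
\<close>

definition partial_matrices :: "('m \<times> 'n) set \<Rightarrow> ('m \<times> 'n \<Rightarrow> real) set" where
  "partial_matrices S = S \<rightarrow>\<^sub>E UNIV"

definition matrix_simplex :: "(real^'n^'m) set" where
  "matrix_simplex = {A. (\<forall>i j. 0 \<le> A $ i $ j) \<and> (\<Sum>i\<in>UNIV. \<Sum>j\<in>UNIV. A $ i $ j) = 1}"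

definition is_completion ::
  "('m \<times> 'n) set \<Rightarrow> ('m \<times> 'n \<Rightarrow> real) \<Rightarrow> real^'n^'m \<Rightarrow> bool" where
  "is_completion S M A \<longleftrightarrow> (\<forall>(i, j)\<in>S. A $ i $ j = M (i, j))"

definition rank_one_completable ::
  "('m::finite \<times> 'n::finite) set \<Rightarrow> ('m \<times> 'n \<Rightarrow> real) set" where
  "rank_one_completable S =
    {M \<in> partial_matrices S. (\<forall>e\<in>S. 0 < M e) \<and>
       (\<exists>A :: real^'n^'m. is_completion S M A \<and> rank A = 1 \<and> A \<in> matrix_simplex)}"

text \<open>
  The graph G(S), as a symmetric adjacency relation on the disjoint union of rows and columns.
  Every row and every column is a vertex, so rows and columns that S does not meet are isolated.
\<close>

definition bip_adj :: "('m \<times> 'n) set \<Rightarrow> ('m + 'n) rel" where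
  "bip_adj S = (\<Union>(i, j)\<in>S. {(Inl i, Inr j), (Inr j, Inl i)})"

definition graph_components :: "('m \<times> 'n) set \<Rightarrow> ('m + 'n) set set" where
  "graph_components S = UNIV // (bip_adj S)\<^sup>*"

definition edge_components :: "('m \<times> 'n) set \<Rightarrow> ('m + 'n) set set" where
  "edge_components S = {C \<in> graph_components S. \<exists>(i, j)\<in>S. Inl i \<in> C \<and> Inr j \<in> C}"

text \<open>
  The edge set of the complete bipartite graph on the row and column vertices in C.
\<close>

definition complete_bip :: "('m + 'n) set \<Rightarrow> ('m \<times> 'n) set" where
  "complete_bip C = {(i, j). Inl i \<in> C \<and> Inr j \<in> C}"

definition graph_closure :: "('m \<times> 'n) set \<Rightarrow> ('m \<times> 'n) set" where
  "graph_closure S = (\<Union>C\<in>graph_components S. complete_bip C)"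

text \<open>
  The cycle with edges (r1,c1), (r1,c2), (r2,c2), ..., (rk,ck), (rk,c1) is given by its lists of
  rows and columns, indexed from 0; the successor of a column index is taken modulo k.
\<close>

definition is_cycle :: "('m \<times> 'n) set \<Rightarrow> 'm list \<Rightarrow> 'n list \<Rightarrow> bool" where
  "is_cycle S rs cs \<longleftrightarrow>
     length cs = length rs \<and> 2 \<le> length rs \<and> distinct rs \<and> distinct cs \<and>
     (\<forall>t<length rs. (rs ! t, cs ! t) \<in> S \<and> (rs ! t, cs ! (Suc t mod length rs)) \<in> S)"

definition cycle_relation :: "('m \<times> 'n \<Rightarrow> real) \<Rightarrow> 'm list \<Rightarrow> 'n list \<Rightarrow> bool" where
  "cycle_relation M rs cs \<longleftrightarrow>
     (\<Prod>t<length rs. M (rs ! t, cs ! t)) =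
     (\<Prod>t<length rs. M (rs ! t, cs ! (Suc t mod length rs)))"

definition all_cycle_relations :: "('m \<times> 'n) set \<Rightarrow> ('m \<times> 'n \<Rightarrow> real) \<Rightarrow> bool" where
  "all_cycle_relations S M \<longleftrightarrow> (\<forall>rs cs. is_cycle S rs cs \<longrightarrow> cycle_relation M rs cs)"

definition completion_cycle ::
  "('m \<times> 'n) set \<Rightarrow> 'm \<Rightarrow> 'n \<Rightarrow> 'm list \<times> 'n list" where
  "completion_cycle S i j =
     (SOME (rs, cs). is_cycle (insert (i, j) S) rs cs \<and> rs ! 0 = i \<and> cs ! 0 = j)"

definition cycle_completion ::
  "('m \<times> 'n \<Rightarrow> real) \<Rightarrow> 'm list \<Rightarrow> 'n list \<Rightarrow> real" where
  "cycle_completion M rs cs =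
     (\<Prod>t<length rs. M (rs ! t, cs ! (Suc t mod length rs))) /
     (\<Prod>t\<in>{1..<length rs}. M (rs ! t, cs ! t))"

text \<open>
  The weight is meaningful only on edges of the transitive closure (where, outside S, a cycle to
  choose exists), and it is independent of the chosen cycle when M is positive and
  satisfies all cycle relations.
\<close>

definition edge_weight ::
  "('m \<times> 'n) set \<Rightarrow> ('m \<times> 'n \<Rightarrow> real) \<Rightarrow> 'm \<times> 'n \<Rightarrow> real" where
  "edge_weight S M = (\<lambda>(i, j).
     if (i, j) \<in> S then M (i, j)
     else (case completion_cycle S i j of (rs, cs) \<Rightarrow> cycle_completion M rs cs))"

definition block_sum ::
  "('m \<times> 'n) set \<Rightarrow> ('m \<times> 'n \<Rightarrow> real) \<Rightarrow> ('m \<times> 'n) set \<Rightarrow> real" where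
  "block_sum S M K = (\<Sum>e\<in>K. edge_weight S M e)"

end

theory Submission imports Defs
begin

text \<open>
  A nonnegative rank-one matrix is an outer product of nonnegative vectors \<open>u\<close> and \<open>v\<close>, and the sum
  of its entries is \<open>(\<Sum>i. u i) * (\<Sum>j. v j)\<close>. So the question is which positive partial matrices can
  be written as \<open>M (i, j) = u i * v j\<close> on \<open>S\<close> with this product of sums equal to one
  (\<open>rank_one_completable_iff\<close>).

  Without the condition on the sum, such potentials \<open>u\<close> and \<open>v\<close> exist exactly when all cycle
  relations hold. Adding one edge at a time, an edge that joins two components can be
  accommodated by rescaling one of them, and an edge inside a component closes a cycle whose
  relation says that the new entry is already correct (\<open>potentials_exist\<close>). Whatever the potentials
  are, the cycle-completion formula telescopes to \<open>u i * v j\<close> on every edge of the transitive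
  closure (\<open>edge_weight_eq\<close>). Hence the weight of the block of a component \<open>C\<close> factors as
  \<open>b = x * y\<close>, where \<open>x\<close> is the sum of \<open>u\<close> over the rows of \<open>C\<close> and \<open>y\<close> the sum of \<open>v\<close> over its
  columns.

  If the graph is connected, the only block is the whole matrix and the condition is \<open>b = 1\<close>.
  Otherwise the remaining freedom is to rescale \<open>(x, y)\<close> to \<open>(t * x, y / t)\<close> independently in every
  component, and to choose values at isolated vertices. The Cauchy-Schwarz inequality gives
  \<open>(\<Sum> sqrt (x * y))\<^sup>2 \<le> (\<Sum> x) * (\<Sum> y) \<le> 1\<close>, which is the necessity of the condition. Conversely, balancing
  every component so that \<open>x = y = sqrt b\<close> attains equality in Cauchy-Schwarz and makes the total
  \<open>(\<Sum> sqrt b)\<^sup>2 \<le> 1\<close> (\<open>balanced_potentials\<close>). A row and a column in different components then allow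
  the total to be raised to exactly one (\<open>raise_total_to_one\<close>): either one of them is free
  to receive more mass, or unbalancing their components makes the total arbitrarily large.
\<close>

definition potentials ::
  "('m \<times> 'n) set \<Rightarrow> ('m \<times> 'n \<Rightarrow> real) \<Rightarrow> ('m \<Rightarrow> real) \<Rightarrow> ('n \<Rightarrow> real) \<Rightarrow> bool" where
  "potentials S M u v \<longleftrightarrow> (\<forall>i j. (i, j) \<in> S \<longrightarrow> M (i, j) = u i * v j)"

lemma potentialsI: "(\<And>i j. (i, j) \<in> S \<Longrightarrow> M (i, j) = u i * v j) \<Longrightarrow> potentials S M u v"
  by (simp add: potentials_def)

lemma potentialsD: "potentials S M u v \<Longrightarrow> (i, j) \<in> S \<Longrightarrow> M (i, j) = u i * v j"
  by (simp add: potentials_def)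

section \<open>Rank-one matrices with entries summing to one\<close>

lemma rank_one_outer_product:
  fixes A :: "real^'n^'m"
  assumes "rank A = 1"
  obtains u :: "'m \<Rightarrow> real" and v :: "'n \<Rightarrow> real" where "\<And>i j. A $ i $ j = u i * v j"
proof -
  obtain B where B: "B \<subseteq> rows A" "rows A \<subseteq> span B" "card B = dim (rows A)"
    using basis_exists[of "rows A"] by metis
  then have "card B = 1" using assms by (simp add: row_rank_def)
  then obtain w where w: "B = {w}" using card_1_singletonE by blast
  have "\<exists>c. row i A = c *\<^sub>R w" for i
    using B(2) by (auto simp: w span_singleton rows_def)
  then obtain u where u: "\<And>i. row i A = u i *\<^sub>R w" by metis
  have "A $ i $ j = u i * w $ j" for i j
    using arg_cong[OF u[of i], of "\<lambda>x. x $ j"] by (simp add: row_def)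
  then show thesis by (rule that)
qed

lemma rank_outer_product:
  fixes A :: "real^'n^'m"
  assumes A: "\<And>i j. A $ i $ j = u i * v j" and "A \<noteq> 0"
  shows "rank A = 1"
proof -
  let ?w = "\<chi> j. v j"
  have "row i A = u i *\<^sub>R ?w" for i
    by (simp add: row_def vec_eq_iff A)
  then have "rows A \<subseteq> span {?w}"
    by (auto simp: rows_def span_singleton)
  then have "dim (rows A) \<le> card {?w}" by (intro dim_le_card) auto
  then have "rank A \<le> 1" by (simp add: row_rank_def)
  moreover have "rank A \<noteq> 0" using \<open>A \<noteq> 0\<close> by (simp add: rank_eq_0)
  ultimately show ?thesis by linarith
qed

lemma rank_one_completable_iff:
  fixes S :: "('m::finite \<times> 'n::finite) set"
  shows "M \<in> rank_one_completable S \<longleftrightarrow>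
    M \<in> partial_matrices S \<and> (\<forall>e\<in>S. 0 < M e) \<and>
    (\<exists>u v. (\<forall>i. 0 \<le> u i) \<and> (\<forall>j. 0 \<le> v j) \<and> potentials S M u v \<and>
       (\<Sum>i\<in>UNIV. u i) * (\<Sum>j\<in>UNIV. v j) = 1)"
    (is "?L \<longleftrightarrow> _ \<and> _ \<and> (\<exists>u v. ?P u v)")
proof
  assume L: ?L
  then obtain A :: "real^'n^'m"
    where A: "is_completion S M A" "rank A = 1" "A \<in> matrix_simplex"
    by (auto simp: rank_one_completable_def)
  obtain u v where uv: "\<And>i j. A $ i $ j = u i * v j"
    using rank_one_outer_product[OF A(2)] by blast
  have eq: "A $ i $ j = \<bar>u i\<bar> * \<bar>v j\<bar>" for i j
    using A(3) unfolding matrix_simplex_def mem_Collect_eq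
    by (metis abs_mult abs_of_nonneg uv)
  have "?P (\<lambda>i. \<bar>u i\<bar>) (\<lambda>j. \<bar>v j\<bar>)"
    using A(1,3)
    by (auto simp: eq sum_product is_completion_def matrix_simplex_def potentials_def)
  moreover have "M \<in> partial_matrices S" "\<forall>e\<in>S. 0 < M e"
    using L by (simp_all add: rank_one_completable_def)
  ultimately show "M \<in> partial_matrices S \<and> (\<forall>e\<in>S. 0 < M e) \<and> (\<exists>u v. ?P u v)"
    by (intro conjI exI[of _ "\<lambda>i. \<bar>u i\<bar>"] exI[of _ "\<lambda>j. \<bar>v j\<bar>"]) simp_all
next
  assume R: "M \<in> partial_matrices S \<and> (\<forall>e\<in>S. 0 < M e) \<and> (\<exists>u v. ?P u v)"
  then obtain u v where uv: "?P u v" by blast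
  define A :: "real^'n^'m" where "A = (\<chi> i j. u i * v j)"
  have A: "A $ i $ j = u i * v j" for i j by (simp add: A_def)
  have total: "(\<Sum>i\<in>UNIV. \<Sum>j\<in>UNIV. A $ i $ j) = 1"
    using uv by (simp add: A sum_product)
  then have "A \<noteq> 0" by auto
  then have "rank A = 1" using A by (intro rank_outer_product[of A u v])
  moreover have "is_completion S M A" using uv by (auto simp: is_completion_def A potentials_def)
  moreover have "A \<in> matrix_simplex" using uv total by (auto simp: matrix_simplex_def A)
  ultimately show ?L using R by (auto simp: rank_one_completable_def)
qed

section \<open>Connected components of the bipartite graph\<close>

lemma equiv_bip_adj_rtrancl: "equiv UNIV ((bip_adj S)\<^sup>*)"
proof (rule equivI)
  have "sym (bip_adj S)" by (auto simp: bip_adj_def sym_def)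
  then show "sym ((bip_adj S)\<^sup>*)" by (rule sym_rtrancl)
qed (auto simp: refl_rtrancl trans_rtrancl)

lemma bip_adj_iff:
  "(Inl i, Inr j) \<in> bip_adj S \<longleftrightarrow> (i, j) \<in> S"
  "(Inr j, Inl i) \<in> bip_adj S \<longleftrightarrow> (i, j) \<in> S"
  "(Inl i, Inl i') \<notin> bip_adj S"
  "(Inr j, Inr j') \<notin> bip_adj S"
  by (auto simp: bip_adj_def)

lemma connected_iff_same_component:
  "D \<in> graph_components S \<Longrightarrow> x \<in> D \<Longrightarrow> (x, y) \<in> (bip_adj S)\<^sup>* \<longleftrightarrow> y \<in> D"
  unfolding graph_components_def
  using in_quotient_imp_closed[OF equiv_bip_adj_rtrancl, of D S x y]
    in_quotient_imp_in_rel[OF equiv_bip_adj_rtrancl, of D S x y]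
  by auto

lemma connected_set_in_graph_components: "(bip_adj S)\<^sup>* `` {w} \<in> graph_components S"
  by (simp add: graph_components_def quotientI)

lemma edge_within_component:
  assumes "D \<in> graph_components S" "(i, j) \<in> S"
  shows "Inl i \<in> D \<longleftrightarrow> Inr j \<in> D"
proof -
  have "(Inl i, Inr j) \<in> (bip_adj S)\<^sup>*" "(Inr j, Inl i) \<in> (bip_adj S)\<^sup>*"
    using assms(2) by (simp_all add: bip_adj_iff r_into_rtrancl)
  then show ?thesis using connected_iff_same_component[OF assms(1)] by blast
qed

lemma complete_bip_eq_Times: "complete_bip D = (Inl -` D) \<times> (Inr -` D)"
  by (auto simp: complete_bip_def)

lemma graph_closure_iff: "(i, j) \<in> graph_closure S \<longleftrightarrow> (Inl i, Inr j) \<in> (bip_adj S)\<^sup>*"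
proof
  assume "(i, j) \<in> graph_closure S"
  then show "(Inl i, Inr j) \<in> (bip_adj S)\<^sup>*"
    using connected_iff_same_component by (fastforce simp: graph_closure_def complete_bip_def)
next
  assume "(Inl i, Inr j) \<in> (bip_adj S)\<^sup>*"
  then show "(i, j) \<in> graph_closure S"
    using connected_set_in_graph_components[of S "Inl i"]
    by (auto simp: graph_closure_def complete_bip_def)
qed

text \<open>
  A component without edges is a single vertex, so its block is empty and contributes zero to any
  sum over blocks. This makes it possible to sum over all components, which partition the vertices.
\<close>

lemma complete_bip_empty:
  assumes "D \<in> graph_components S" "D \<notin> edge_components S"
  shows "complete_bip D = {}"
proof (rule ccontr)
  assume "complete_bip D \<noteq> {}"
  then obtain i j where ij: "Inl i \<in> D" "Inr j \<in> D" by (auto simp: complete_bip_def)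
  then have "(Inl i, Inr j) \<in> (bip_adj S)\<^sup>*"
    using assms(1) connected_iff_same_component by blast
  then obtain w where w: "(Inl i, w) \<in> bip_adj S"
    by (cases rule: converse_rtranclE) auto
  then obtain j' where "w = Inr j'" "(i, j') \<in> S" by (cases w) (auto simp: bip_adj_iff)
  then have "D \<in> edge_components S"
    using assms(1) ij(1) edge_within_component by (fastforce simp: edge_components_def)
  with assms(2) show False by simp
qed

lemma sum_over_components:
  fixes g :: "'a::finite \<Rightarrow> 'm::finite + 'n::finite" and f :: "'a \<Rightarrow> real"
  shows "(\<Sum>D\<in>graph_components S. \<Sum>x\<in>g -` D. f x) = (\<Sum>x\<in>UNIV. f x)"
proof -
  have "(\<Sum>x\<in>(\<Union>D\<in>graph_components S. g -` D). f x) =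
      (\<Sum>D\<in>graph_components S. \<Sum>x\<in>g -` D. f x)"
  proof (rule sum.UNION_disjoint)
    show "\<forall>A\<in>graph_components S. \<forall>B\<in>graph_components S. A \<noteq> B \<longrightarrow> g -` A \<inter> g -` B = {}"
      using quotient_disj[OF equiv_bip_adj_rtrancl[of S]] unfolding graph_components_def by blast
  qed auto
  moreover have "(\<Union>D\<in>graph_components S. g -` D) = UNIV"
    using Union_quotient[OF equiv_bip_adj_rtrancl[of S]]
    by (simp add: graph_components_def flip: vimage_Union)
  ultimately show ?thesis by simp
qed

section \<open>Cycles through a prescribed edge\<close>

text \<open>
  A shortest path from row \<open>i\<close> to column \<open>j\<close> repeats no vertex; since it alternates between rows and
  columns and \<open>(i, j)\<close> is not an edge, it has odd length at least three and is closed to a cycle by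
  \<open>(i, j)\<close>.
\<close>

lemma cycle_through_new_edge:
  assumes conn: "(Inl i, Inr j) \<in> (bip_adj S)\<^sup>*" and new: "(i, j) \<notin> S"
  obtains rs cs where "is_cycle (insert (i, j) S) rs cs" "rs ! 0 = i" "cs ! 0 = j"
proof -
  let ?R = "bip_adj S"
  define n where "n = (LEAST n. (Inl i, Inr j) \<in> ?R ^^ n)"
  have n: "(Inl i, Inr j) \<in> ?R ^^ n"
    unfolding n_def using rtrancl_imp_relpow[OF conn] by (metis LeastI)
  have least: "n \<le> n'" if "(Inl i, Inr j) \<in> ?R ^^ n'" for n'
    unfolding n_def using that by (rule Least_le)
  obtain f where f: "f 0 = Inl i" "f n = Inr j" "\<And>t. t < n \<Longrightarrow> (f t, f (Suc t)) \<in> ?R"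
    using n unfolding relpow_fun_conv by blast
  \<comment> \<open>A repeated vertex would allow the part of the path between its two visits to be cut out.\<close>
  have distinct: "f a \<noteq> f b" if "a < b" "b \<le> n" for a b
  proof
    assume eq: "f a = f b"
    have "(f 0, f a) \<in> ?R ^^ a"
      unfolding relpow_fun_conv using f(3) that by (intro exI[of _ f]) auto
    moreover have "(f b, f n) \<in> ?R ^^ (n - b)"
      unfolding relpow_fun_conv using f(3) that by (intro exI[of _ "\<lambda>t. f (b + t)"]) auto
    ultimately have "(Inl i, Inr j) \<in> ?R ^^ (a + (n - b))"
      unfolding relpow_add using f(1,2) eq by auto
    from least[OF this] that show False by linarith
  qed
  have inj: "a = b" if "f a = f b" "a \<le> n" "b \<le> n" for a b
    using distinct that by (metis linorder_neqE_nat)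
  have alternate: "t \<le> n \<Longrightarrow> isl (f t) = even t" for t
  proof (induction t)
    case (Suc t)
    have "isl (f (Suc t)) = (\<not> isl (f t))"
      using f(3)[of t] Suc.prems
      by (cases "f t"; cases "f (Suc t)") (auto simp: bip_adj_iff)
    then show ?case using Suc by simp
  qed (simp add: f)
  have "odd n" using alternate[of n] f(2) by simp
  then obtain m where m: "n = 2 * m + 1" by (elim oddE)
  define k where "k = Suc m"
  have nk: "n = 2 * k - 1" by (simp add: m k_def)
  have "m \<noteq> 0" using f(1,2) f(3)[of 0] new m by (intro notI) (simp add: bip_adj_iff)
  then have k2: "2 \<le> k" by (simp add: k_def)
  have row: "f (2 * t) = Inl (projl (f (2 * t)))" if "t < k" for t
    using alternate[of "2 * t"] that nk by simp
  have col: "f (2 * t + 1) = Inr (projr (f (2 * t + 1)))" if "t < k" for t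
  proof -
    have "2 * t + 1 \<le> n" using that nk by linarith
    then show ?thesis using alternate[of "2 * t + 1"] by (cases "f (2 * t + 1)") simp_all
  qed
  \<comment> \<open>The cycle is listed from the new edge on: its column \<open>j\<close> comes first although the path visits
      it last. With the successor of the index taken modulo \<open>k\<close>, this shift is uniform.\<close>
  define rs where "rs = map (\<lambda>t. projl (f (2 * t))) [0..<k]"
  define cs where "cs = map (\<lambda>t. if t = 0 then j else projr (f (2 * t - 1))) [0..<k]"
  have len: "length rs = k" "length cs = k" by (simp_all add: rs_def cs_def)
  have rs: "rs ! t = projl (f (2 * t))" if "t < k" for t using that by (simp add: rs_def)
  have cs: "cs ! t = (if t = 0 then j else projr (f (2 * t - 1)))" if "t < k" for t
    using that by (simp add: cs_def)
  have cs_Suc: "cs ! (Suc t mod k) = projr (f (2 * t + 1))" if "t < k" for t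
  proof (cases "Suc t = k")
    case True
    then have "2 * t + 1 = n" using nk by simp
    then show ?thesis using cs[of 0] k2 True f(2) by simp
  next
    case False
    then show ?thesis using that cs[of "Suc t"] by simp
  qed
  have e0: "(rs ! 0, cs ! 0) = (i, j)" using k2 rs[of 0] cs[of 0] f(1) by simp
  have e1: "(rs ! t, cs ! (Suc t mod k)) \<in> S" if "t < k" for t
  proof -
    have "(f (2 * t), f (2 * t + 1)) \<in> ?R" using f(3)[of "2 * t"] that nk by simp
    then show ?thesis
      using row[OF that] col[OF that] rs[OF that] cs_Suc[OF that] by (metis bip_adj_iff(1))
  qed
  have e2: "(rs ! t, cs ! t) \<in> S" if t: "t < k" "t \<noteq> 0" for t
  proof -
    obtain q where q: "t = Suc q" using t(2) by (cases t) auto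
    have "(f (2 * q + 1), f (2 * t)) \<in> ?R" using f(3)[of "2 * q + 1"] t(1) nk q by simp
    moreover have "cs ! t = projr (f (2 * q + 1))" using cs[OF t(1)] q by simp
    ultimately show ?thesis
      using row[OF t(1)] col[of q] rs[OF t(1)] t(1) q by (metis bip_adj_iff(2) Suc_lessD)
  qed
  have "distinct rs"
    unfolding distinct_conv_nth len
  proof (intro allI impI)
    fix a b assume ab: "a < k" "b < k" "a \<noteq> b"
    then have "f (2 * a) \<noteq> f (2 * b)" using inj[of "2 * a" "2 * b"] nk by fastforce
    then show "rs ! a \<noteq> rs ! b" using row ab rs by metis
  qed
  moreover have "distinct cs"
  proof -
    have "cs ! (Suc a mod k) \<noteq> cs ! (Suc b mod k)" if ab: "a < k" "b < k" "a \<noteq> b" for a b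
    proof -
      have "f (2 * a + 1) \<noteq> f (2 * b + 1)" using inj[of "2 * a + 1" "2 * b + 1"] ab nk by fastforce
      then show ?thesis using col ab cs_Suc by metis
    qed
    moreover have "\<exists>a<k. t = Suc a mod k" if "t < k" for t
    proof (cases t)
      case 0
      then show ?thesis using k2 by (intro exI[of _ "k - 1"]) auto
    next
      case (Suc a)
      then show ?thesis using that by (intro exI[of _ a]) auto
    qed
    ultimately show ?thesis unfolding distinct_conv_nth len by metis
  qed
  moreover have "(rs ! t, cs ! t) \<in> insert (i, j) S" if "t < k" for t
    using e0 e2[OF that] by (cases "t = 0") simp_all
  ultimately have "is_cycle (insert (i, j) S) rs cs"
    unfolding is_cycle_def len using k2 e1 by simp
  then show thesis using e0 by (intro that[of rs cs]) auto
qed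

text \<open>
  Since rows and columns of a cycle are distinct, its first edge occurs only once.
\<close>

lemma cycle_edges_outside_new_edge:
  assumes "is_cycle (insert (i, j) S) rs cs" "rs ! 0 = i" "cs ! 0 = j" "t < length rs"
  shows "(rs ! t, cs ! (Suc t mod length rs)) \<in> S"
    and "t \<noteq> 0 \<Longrightarrow> (rs ! t, cs ! t) \<in> S"
proof -
  let ?k = "length rs"
  have k: "length cs = ?k" "2 \<le> ?k" "distinct rs" "distinct cs"
    and edges: "(rs ! t, cs ! t) \<in> insert (i, j) S"
      "(rs ! t, cs ! (Suc t mod ?k)) \<in> insert (i, j) S"
    using assms(1,4) by (auto simp: is_cycle_def)
  have row: "rs ! t = i \<longleftrightarrow> t = 0"
    using k(2) assms(2,4) nth_eq_iff_index_eq[OF k(3), of t 0] by fastforce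
  then show "t \<noteq> 0 \<Longrightarrow> (rs ! t, cs ! t) \<in> S" using edges(1) by auto
  have "cs ! (Suc 0 mod ?k) \<noteq> j"
    using k(1,2) assms(3) nth_eq_iff_index_eq[OF k(4), of 1 0] by fastforce
  then show "(rs ! t, cs ! (Suc t mod ?k)) \<in> S" using edges(2) row by auto
qed

lemma prod_Suc_mod:
  fixes f :: "nat \<Rightarrow> real"
  shows "(\<Prod>t<k. f (Suc t mod k)) = (\<Prod>t<k. f t)"
proof (cases k)
  case (Suc m)
  have "(\<Prod>t<Suc m. f (Suc t mod Suc m)) = (\<Prod>t<m. f (Suc t)) * f 0"
    by (simp add: prod.lessThan_Suc)
  also have "\<dots> = (\<Prod>t<Suc m. f t)" by (simp add: prod.lessThan_Suc_shift del: prod.lessThan_Suc)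
  finally show ?thesis by (simp only: Suc)
qed simp

lemma prod_lessThan_split_first:
  fixes f :: "nat \<Rightarrow> real"
  assumes "0 < k"
  shows "(\<Prod>t<k. f t) = f 0 * (\<Prod>t\<in>{1..<k}. f t)"
  using assms by (simp add: lessThan_atLeast0 prod.atLeast_Suc_lessThan)

text \<open>
  Each row and each column of the cycle occurs once in the numerator. All of them except the row
  and the column of the first edge occur once in the denominator, so only \<open>u i\<close> and \<open>v j\<close> survive.
\<close>

lemma cycle_completion_eq:
  assumes cyc: "is_cycle (insert (i, j) S) rs cs" "rs ! 0 = i" "cs ! 0 = j"
    and uv: "potentials S M u v"
    and nz: "\<forall>e\<in>S. M e \<noteq> 0"
  shows "cycle_completion M rs cs = u i * v j"
proof -
  let ?k = "length rs"
  have k: "0 < ?k" using cyc(1) by (auto simp: is_cycle_def)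
  have "(\<Prod>t<?k. M (rs ! t, cs ! (Suc t mod ?k))) = (\<Prod>t<?k. u (rs ! t) * v (cs ! (Suc t mod ?k)))"
    using cycle_edges_outside_new_edge(1)[OF cyc] potentialsD[OF uv] by (intro prod.cong) auto
  also have "\<dots> = (\<Prod>t<?k. u (rs ! t) * v (cs ! t))"
    using prod_Suc_mod[of "\<lambda>t. v (cs ! t)" ?k] by (simp add: prod.distrib)
  also have "\<dots> = u i * v j * (\<Prod>t\<in>{1..<?k}. u (rs ! t) * v (cs ! t))"
    using prod_lessThan_split_first[OF k, of "\<lambda>t. u (rs ! t) * v (cs ! t)"] cyc by simp
  also have "(\<Prod>t\<in>{1..<?k}. u (rs ! t) * v (cs ! t)) = (\<Prod>t\<in>{1..<?k}. M (rs ! t, cs ! t))"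
    using cycle_edges_outside_new_edge(2)[OF cyc] potentialsD[OF uv] by (intro prod.cong) auto
  finally have num: "(\<Prod>t<?k. M (rs ! t, cs ! (Suc t mod ?k))) =
      u i * v j * (\<Prod>t\<in>{1..<?k}. M (rs ! t, cs ! t))" .
  have "M (rs ! t, cs ! t) \<noteq> 0" if "t \<in> {1..<?k}" for t
    using cycle_edges_outside_new_edge(2)[OF cyc, of t] that nz by auto
  then have "(\<Prod>t\<in>{1..<?k}. M (rs ! t, cs ! t)) \<noteq> 0" by simp
  with num show ?thesis by (simp add: cycle_completion_def)
qed

lemma cycle_relation_imp_completion:
  assumes cyc: "is_cycle (insert (i, j) S) rs cs" "rs ! 0 = i" "cs ! 0 = j"
    and rel: "cycle_relation M rs cs"
    and nz: "\<forall>e\<in>S. M e \<noteq> 0"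
  shows "M (i, j) = cycle_completion M rs cs"
proof -
  let ?k = "length rs"
  have k: "0 < ?k" using cyc(1) by (auto simp: is_cycle_def)
  have "M (i, j) * (\<Prod>t\<in>{1..<?k}. M (rs ! t, cs ! t)) = (\<Prod>t<?k. M (rs ! t, cs ! t))"
    using prod_lessThan_split_first[OF k, of "\<lambda>t. M (rs ! t, cs ! t)"] cyc by simp
  also have "\<dots> = (\<Prod>t<?k. M (rs ! t, cs ! (Suc t mod ?k)))"
    using rel by (simp add: cycle_relation_def)
  finally have eq: "M (i, j) * (\<Prod>t\<in>{1..<?k}. M (rs ! t, cs ! t)) =
      (\<Prod>t<?k. M (rs ! t, cs ! (Suc t mod ?k)))" .
  have "M (rs ! t, cs ! t) \<noteq> 0" if "t \<in> {1..<?k}" for t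
    using cycle_edges_outside_new_edge(2)[OF cyc, of t] that nz by auto
  then have "(\<Prod>t\<in>{1..<?k}. M (rs ! t, cs ! t)) \<noteq> 0" by simp
  with eq show ?thesis by (simp add: cycle_completion_def field_simps)
qed

section \<open>Potentials\<close>

lemma potentials_imp_cycle_relations:
  assumes uv: "potentials S M u v"
  shows "all_cycle_relations S M"
  unfolding all_cycle_relations_def cycle_relation_def
proof (intro allI impI)
  fix rs cs assume cyc: "is_cycle S rs cs"
  let ?k = "length rs"
  have "(\<Prod>t<?k. M (rs ! t, cs ! t)) = (\<Prod>t<?k. u (rs ! t) * v (cs ! t))"
    using cyc potentialsD[OF uv] by (intro prod.cong) (auto simp: is_cycle_def)
  also have "\<dots> = (\<Prod>t<?k. u (rs ! t) * v (cs ! (Suc t mod ?k)))"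
    using prod_Suc_mod[of "\<lambda>t. v (cs ! t)" ?k] by (simp add: prod.distrib)
  also have "\<dots> = (\<Prod>t<?k. M (rs ! t, cs ! (Suc t mod ?k)))"
    using cyc potentialsD[OF uv] by (intro prod.cong) (auto simp: is_cycle_def)
  finally show "(\<Prod>t<?k. M (rs ! t, cs ! t)) = (\<Prod>t<?k. M (rs ! t, cs ! (Suc t mod ?k)))" .
qed

lemma edge_weight_eq:
  assumes uv: "potentials S M u v"
    and nz: "\<forall>e\<in>S. M e \<noteq> 0"
    and conn: "(Inl i, Inr j) \<in> (bip_adj S)\<^sup>*"
  shows "edge_weight S M (i, j) = u i * v j"
proof (cases "(i, j) \<in> S")
  case True
  then show ?thesis using potentialsD[OF uv] by (simp add: edge_weight_def)
next
  case False
  obtain rs cs where rc: "completion_cycle S i j = (rs, cs)" by (cases "completion_cycle S i j")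
  obtain rs' cs' where "is_cycle (insert (i, j) S) rs' cs' \<and> rs' ! 0 = i \<and> cs' ! 0 = j"
    using cycle_through_new_edge[OF conn False] by blast
  then have "(\<lambda>(rs, cs). is_cycle (insert (i, j) S) rs cs \<and> rs ! 0 = i \<and> cs ! 0 = j) (rs', cs')"
    by simp
  then have "(\<lambda>(rs, cs). is_cycle (insert (i, j) S) rs cs \<and> rs ! 0 = i \<and> cs ! 0 = j)
      (completion_cycle S i j)"
    unfolding completion_cycle_def by (rule someI)
  then have "cycle_completion M rs cs = u i * v j"
    using rc uv nz by (intro cycle_completion_eq[of i j S]) auto
  then show ?thesis using False rc by (simp add: edge_weight_def)
qed

lemma block_sum_eq:
  assumes uv: "potentials S M u v"
    and nz: "\<forall>e\<in>S. M e \<noteq> 0"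
    and D: "D \<in> graph_components S"
  shows "block_sum S M (complete_bip D) = (\<Sum>i\<in>Inl -` D. u i) * (\<Sum>j\<in>Inr -` D. v j)"
proof -
  have "edge_weight S M (i, j) = u i * v j" if "i \<in> Inl -` D" "j \<in> Inr -` D" for i j
    using that connected_iff_same_component[OF D] by (intro edge_weight_eq uv nz) auto
  then show ?thesis
    unfolding block_sum_def complete_bip_eq_Times sum_product sum.cartesian_product
    by (intro sum.cong) auto
qed

text \<open>
  Multiplying the row potentials of one component by a factor and dividing its column potentials by
  it changes no product along an edge, but it changes the products between this
  component and the others freely.
\<close>

definition scale_rows :: "('m + 'n) set \<Rightarrow> real \<Rightarrow> ('m \<Rightarrow> real) \<Rightarrow> 'm \<Rightarrow> real" where
  "scale_rows D a u = (\<lambda>i. if Inl i \<in> D then a * u i else u i)"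

definition scale_cols :: "('m + 'n) set \<Rightarrow> real \<Rightarrow> ('n \<Rightarrow> real) \<Rightarrow> 'n \<Rightarrow> real" where
  "scale_cols D a v = (\<lambda>j. if Inr j \<in> D then v j / a else v j)"

lemma scale_edge:
  assumes "D \<in> graph_components S" "(i, j) \<in> S" "a \<noteq> 0"
  shows "scale_rows D a u i * scale_cols D a v j = u i * v j"
  using edge_within_component[OF assms(1,2)] assms(3) by (simp add: scale_rows_def scale_cols_def)

lemma scale_pos:
  assumes "0 < a"
  shows "0 < u i \<Longrightarrow> 0 < scale_rows D a u i" "0 < v j \<Longrightarrow> 0 < scale_cols D a v j"
  using assms by (simp_all add: scale_rows_def scale_cols_def)

text \<open>
  Potentials for \<open>S\<close> are adapted to a further edge \<open>(i, j)\<close>. If it closes a cycle, the cycle relation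
  and the telescoping of the completion formula both determine \<open>M (i, j)\<close>, which thus is already
  \<open>u i * v j\<close>. Otherwise scaling the component of row \<open>i\<close> corrects the new product and preserves all
  the old ones.
\<close>

lemma potentials_exist:
  fixes S :: "('m::finite \<times> 'n::finite) set"
  assumes "all_cycle_relations S M" "\<forall>e\<in>S. 0 < M e"
  shows "\<exists>u v. (\<forall>i. 0 < u i) \<and> (\<forall>j. 0 < v j) \<and> potentials S M u v"
  using finite[of S] assms
proof (induction S rule: finite_induct)
  case empty
  show ?case by (intro exI[of _ "\<lambda>_. 1"]) (auto simp: potentials_def)
next
  case (insert e S)
  obtain i j where e: "e = (i, j)" by (cases e)
  have "all_cycle_relations S M"
    using insert.prems(1) by (auto simp: all_cycle_relations_def is_cycle_def)
  then obtain u v where pos: "\<And>i. 0 < u i" "\<And>j. 0 < v j"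
    and uv: "potentials S M u v"
    using insert by auto
  have nz: "\<forall>e\<in>S. M e \<noteq> 0" using insert.prems(2) by fastforce
  show ?case
  proof (cases "(Inl i, Inr j) \<in> (bip_adj S)\<^sup>*")
    case True
    obtain rs cs where cyc: "is_cycle (insert (i, j) S) rs cs" "rs ! 0 = i" "cs ! 0 = j"
      using cycle_through_new_edge True insert.hyps(2) e by metis
    have "cycle_relation M rs cs"
      using insert.prems(1) cyc(1) e by (auto simp: all_cycle_relations_def)
    then have "M (i, j) = u i * v j"
      using cycle_relation_imp_completion[OF cyc _ nz] cycle_completion_eq[OF cyc uv nz] by simp
    then show ?thesis
      using pos uv e by (intro exI[of _ u] exI[of _ v]) (auto simp: potentials_def)
  next
    case False
    let ?D = "(bip_adj S)\<^sup>* `` {Inl i}"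
    let ?a = "M (i, j) / (u i * v j)"
    have a: "0 < ?a" using insert.prems(2) e pos by simp
    have "scale_rows ?D ?a u i * scale_cols ?D ?a v j = M (i, j)"
      using False pos(1)[of i] pos(2)[of j] by (simp add: scale_rows_def scale_cols_def)
    moreover have "scale_rows ?D ?a u i' * scale_cols ?D ?a v j' = M (i', j')" if "(i', j') \<in> S" for i' j'
      using scale_edge[OF connected_set_in_graph_components that less_imp_neq[OF a, symmetric]]
        potentialsD[OF uv that] by simp
    moreover have "0 < scale_rows ?D ?a u i'" for i' by (intro scale_pos a pos)
    moreover have "0 < scale_cols ?D ?a v j'" for j' by (intro scale_pos a pos)
    ultimately show ?thesis
      using e by (intro exI[of _ "scale_rows ?D ?a u"] exI[of _ "scale_cols ?D ?a v"])
        (auto simp: potentials_def)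
  qed
qed

section \<open>Necessity of the bound on the blocks\<close>

lemma sum_sqrt_mult_le:
  fixes x y :: "'a \<Rightarrow> real"
  assumes "\<And>a. a \<in> A \<Longrightarrow> 0 \<le> x a" "\<And>a. a \<in> A \<Longrightarrow> 0 \<le> y a"
  shows "(\<Sum>a\<in>A. sqrt (x a * y a)) \<le> sqrt (sum x A * sum y A)"
proof -
  have "(\<Sum>a\<in>A. sqrt (x a) * sqrt (y a))\<^sup>2 \<le> (\<Sum>a\<in>A. (sqrt (x a))\<^sup>2) * (\<Sum>a\<in>A. (sqrt (y a))\<^sup>2)"
    by (rule Cauchy_Schwarz_ineq_sum)
  also have "\<dots> = sum x A * sum y A" using assms by simp
  finally show ?thesis by (intro real_le_rsqrt) (simp add: real_sqrt_mult)
qed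

lemma sum_sqrt_blocks_le:
  fixes S :: "('m::finite \<times> 'n::finite) set"
  assumes uv: "potentials S M u v"
    and nz: "\<forall>e\<in>S. M e \<noteq> 0"
    and nonneg: "\<And>i. 0 \<le> u i" "\<And>j. 0 \<le> v j"
  shows "(\<Sum>D\<in>graph_components S. sqrt (block_sum S M (complete_bip D)))
    \<le> sqrt ((\<Sum>i\<in>UNIV. u i) * (\<Sum>j\<in>UNIV. v j))"
proof -
  let ?x = "\<lambda>D::('m + 'n) set. \<Sum>i\<in>Inl -` D. u i" and ?y = "\<lambda>D::('m + 'n) set. \<Sum>j\<in>Inr -` D. v j"
  have "(\<Sum>D\<in>graph_components S. sqrt (block_sum S M (complete_bip D)))
      = (\<Sum>D\<in>graph_components S. sqrt (?x D * ?y D))"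
    using block_sum_eq[OF uv nz] by (intro sum.cong) auto
  also have "\<dots> \<le> sqrt (sum ?x (graph_components S) * sum ?y (graph_components S))"
    by (intro sum_sqrt_mult_le sum_nonneg nonneg)
  finally show ?thesis by (simp add: sum_over_components)
qed

section \<open>Sufficiency of the bound on the blocks\<close>

text \<open>
  Cauchy-Schwarz is tight when the row sums of the components are proportional to their column sums.
  Scaling every component by the square root of the ratio of the two sums makes them equal. A row in
  a component without columns gets potential \<open>sqrt (0 / x) = 0\<close>, as it should: isolated vertices carry no mass. The
  same holds for isolated columns.
\<close>

lemma balanced_potentials:
  fixes S :: "('m::finite \<times> 'n::finite) set"
  assumes rel: "all_cycle_relations S M" and pos: "\<forall>e\<in>S. 0 < M e"
  obtains u v where "\<And>i. 0 \<le> u i" "\<And>j. 0 \<le> v j"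
    "potentials S M u v"
    "(\<Sum>i\<in>UNIV. u i) = (\<Sum>D\<in>graph_components S. sqrt (block_sum S M (complete_bip D)))"
    "(\<Sum>j\<in>UNIV. v j) = (\<Sum>D\<in>graph_components S. sqrt (block_sum S M (complete_bip D)))"
proof -
  obtain u v where uvpos: "\<And>i. 0 < u i" "\<And>j. 0 < v j"
    and uv: "potentials S M u v"
    using potentials_exist[OF rel pos] by blast
  have nz: "\<forall>e\<in>S. M e \<noteq> 0" using pos by force
  define x where "x D = (\<Sum>i\<in>Inl -` D. u i)" for D :: "('m + 'n) set"
  define y where "y D = (\<Sum>j\<in>Inr -` D. v j)" for D :: "('m + 'n) set"
  define comp where "comp w = (bip_adj S)\<^sup>* `` {w}" for w
  define u' where "u' i = u i * sqrt (y (comp (Inl i)) / x (comp (Inl i)))" for i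
  define v' where "v' j = v j * sqrt (x (comp (Inr j)) / y (comp (Inr j)))" for j
  have comp: "comp w = D" if "D \<in> graph_components S" "w \<in> D" for w D
    using connected_iff_same_component[OF that] by (auto simp: comp_def)
  have x0: "0 \<le> x D" and y0: "0 \<le> y D" for D
    unfolding x_def y_def by (auto intro!: sum_nonneg uvpos[THEN less_imp_le])
  have block: "block_sum S M (complete_bip D) = x D * y D" if "D \<in> graph_components S" for D
    unfolding x_def y_def using that by (intro block_sum_eq uv nz) auto
  have scale: "a * sqrt (b / a) = sqrt (a * b)" if "0 \<le> a" for a b :: real
    using that by (cases "a = 0") (simp_all add: real_sqrt_divide real_sqrt_mult field_simps)
  have "(\<Sum>i\<in>Inl -` D. u' i) = sqrt (block_sum S M (complete_bip D))"
    if D: "D \<in> graph_components S" for D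
  proof -
    have "(\<Sum>i\<in>Inl -` D. u' i) = (\<Sum>i\<in>Inl -` D. u i * sqrt (y D / x D))"
      using comp[OF D] by (intro sum.cong) (auto simp: u'_def)
    also have "\<dots> = x D * sqrt (y D / x D)" by (simp only: x_def sum_distrib_right)
    finally show ?thesis using block[OF D] scale[OF x0] by simp
  qed
  then have U: "(\<Sum>i\<in>UNIV. u' i) = (\<Sum>D\<in>graph_components S. sqrt (block_sum S M (complete_bip D)))"
    by (simp add: sum_over_components[where g = Inl and S = S, symmetric])
  have "(\<Sum>j\<in>Inr -` D. v' j) = sqrt (block_sum S M (complete_bip D))"
    if D: "D \<in> graph_components S" for D
  proof -
    have "(\<Sum>j\<in>Inr -` D. v' j) = (\<Sum>j\<in>Inr -` D. v j * sqrt (x D / y D))"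
      using comp[OF D] by (intro sum.cong) (auto simp: v'_def)
    also have "\<dots> = y D * sqrt (x D / y D)" by (simp only: y_def sum_distrib_right)
    finally show ?thesis using block[OF D] scale[OF y0] by (simp add: mult.commute)
  qed
  then have V: "(\<Sum>j\<in>UNIV. v' j) = (\<Sum>D\<in>graph_components S. sqrt (block_sum S M (complete_bip D)))"
    by (simp add: sum_over_components[where g = Inr and S = S, symmetric])
  have "potentials S M u' v'"
  proof (rule potentialsI)
    fix i j assume e: "(i, j) \<in> S"
    let ?D = "comp (Inl i)"
    have D: "?D \<in> graph_components S" unfolding comp_def by (rule connected_set_in_graph_components)
    have ij: "Inl i \<in> ?D" "Inr j \<in> ?D"
      using edge_within_component[OF D e] by (auto simp: comp_def)
    have "0 < x ?D" "0 < y ?D"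
      unfolding x_def y_def using ij uvpos
      by (auto intro!: sum_pos2[where i = i] sum_pos2[where i = j] less_imp_le)
    then have "sqrt (y ?D / x ?D) * sqrt (x ?D / y ?D) = 1"
      by (simp flip: real_sqrt_mult)
    moreover have "comp (Inr j) = ?D" using comp[OF D ij(2)] .
    ultimately show "M (i, j) = u' i * v' j" using potentialsD[OF uv e] by (simp add: u'_def v'_def algebra_simps)
  qed
  moreover have "0 \<le> u' i" for i using x0 y0 uvpos(1)[of i] by (simp add: u'_def)
  moreover have "0 \<le> v' j" for j using x0 y0 uvpos(2)[of j] by (simp add: v'_def)
  ultimately show thesis using U V that[of u' v'] by blast
qed

lemma unbalance_to_one:
  fixes a a' c c' :: real
  assumes "0 < a" "0 < c'" "0 \<le> a'" "0 \<le> c" and le: "(a + c) * (a' + c') \<le> 1"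
  obtains t where "0 < t" "(t * a + c) * (a' / t + c') = 1"
proof -
  let ?f = "\<lambda>t. (t * a + c) * (a' / t + c')"
  have "a * c' \<le> (a + c) * (a' + c')" using assms by (intro mult_mono) auto
  then have ac: "0 < a * c'" "a * c' \<le> 1" using assms by auto
  \<comment> \<open>At \<open>t = 1 / (a * c')\<close> the single term \<open>t * a * c'\<close> of the product is already one.\<close>
  have "1 = (1 / (a * c') * a) * c'" using assms by simp
  also have "\<dots> \<le> ?f (1 / (a * c'))" using assms by (intro mult_mono) auto
  finally have "1 \<le> ?f (1 / (a * c'))" .
  moreover have "?f 1 \<le> 1" using le by simp
  moreover have "1 \<le> 1 / (a * c')" using ac by simp
  moreover have "continuous_on {1..1 / (a * c')} ?f" by (intro continuous_intros) auto
  ultimately obtain t where "1 \<le> t" "?f t = 1" using IVT'[of ?f 1 1 "1 / (a * c')"] by auto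
  then show thesis by (intro that[of t]) auto
qed

text \<open>
  If one of the two unconnected vertices has potential zero, no edge is incident with it and its
  potential can be raised. Otherwise the product of the potentials of this row and this
  column is positive and, as they lie in different components, can be made as large as desired.
\<close>

lemma raise_total_to_one:
  fixes S :: "('m::finite \<times> 'n::finite) set"
  assumes pos: "\<forall>e\<in>S. 0 < M e" and u: "\<And>i. 0 \<le> u i" and v: "\<And>j. 0 \<le> v j"
    and uv: "potentials S M u v"
    and le: "(\<Sum>i\<in>UNIV. u i) * (\<Sum>j\<in>UNIV. v j) \<le> 1"
    and unconn: "(Inl i0, Inr j0) \<notin> (bip_adj S)\<^sup>*"
  shows "\<exists>u v. (\<forall>i. 0 \<le> u i) \<and> (\<forall>j. 0 \<le> v j) \<and> potentials S M u v \<and>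
    (\<Sum>i\<in>UNIV. u i) * (\<Sum>j\<in>UNIV. v j) = 1"
proof (cases "S = {}")
  \<comment> \<open>Raising the potential of one vertex only helps if the opposite sum is positive; this is
      guaranteed by an edge, so the empty pattern is treated separately.\<close>
  case True
  show ?thesis
    by (rule exI[of _ "\<lambda>i. if i = i0 then 1 else 0"], rule exI[of _ "\<lambda>j. if j = j0 then 1 else 0"])
      (auto simp: True potentials_def)
next
  case False
  let ?U = "\<Sum>i\<in>UNIV. u i" and ?V = "\<Sum>j\<in>UNIV. v j"
  obtain p q where pq: "(p, q) \<in> S" using False by fastforce
  have nz: "u i \<noteq> 0 \<and> v j \<noteq> 0" if "(i, j) \<in> S" for i j
    using pos potentialsD[OF uv that] that by force
  have U: "0 < ?U" using u nz[OF pq] by (intro sum_pos2[of _ p]) (auto simp: less_le)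
  have V: "0 < ?V" using v nz[OF pq] by (intro sum_pos2[of _ q]) (auto simp: less_le)
  consider "u i0 = 0" | "v j0 = 0" | "0 < u i0" "0 < v j0" using u v by (metis less_le)
  then show ?thesis
  proof cases
    case 1
    let ?u = "u(i0 := 1 / ?V - ?U)"
    have "sum ?u UNIV = 1 / ?V - ?U + sum u (UNIV - {i0})"
      by (subst sum.remove[of _ i0]) auto
    moreover have "?U = sum u (UNIV - {i0})"
      using 1 by (subst sum.remove[of _ i0]) auto
    ultimately have "sum ?u UNIV * ?V = 1" using V by simp
    moreover have "0 \<le> 1 / ?V - ?U" using le V by (simp add: field_simps)
    ultimately show ?thesis
      using u v uv nz 1 by (intro exI[of _ ?u] exI[of _ v]) (auto simp: potentials_def)
  next
    case 2
    let ?v = "v(j0 := 1 / ?U - ?V)"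
    have "sum ?v UNIV = 1 / ?U - ?V + sum v (UNIV - {j0})"
      by (subst sum.remove[of _ j0]) auto
    moreover have "?V = sum v (UNIV - {j0})"
      using 2 by (subst sum.remove[of _ j0]) auto
    ultimately have "?U * sum ?v UNIV = 1" using U by simp
    moreover have "0 \<le> 1 / ?U - ?V" using le U by (simp add: field_simps)
    ultimately show ?thesis
      using u v uv nz 2 by (intro exI[of _ u] exI[of _ ?v]) (auto simp: potentials_def)
  next
    case 3
    let ?D = "(bip_adj S)\<^sup>* `` {Inl i0}"
    let ?a = "sum u {i. Inl i \<in> ?D}" and ?c = "sum u {i. Inl i \<notin> ?D}"
    let ?a' = "sum v {j. Inr j \<in> ?D}" and ?c' = "sum v {j. Inr j \<notin> ?D}"
    have rows: "sum (scale_rows ?D t u) UNIV = t * ?a + ?c" for t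
      by (simp add: scale_rows_def sum.If_cases sum_distrib_left Collect_neg_eq)
    have cols: "sum (scale_cols ?D t v) UNIV = ?a' / t + ?c'" for t
      by (simp add: scale_cols_def sum.If_cases sum_divide_distrib Collect_neg_eq)
    have "scale_rows ?D 1 u = u" "scale_cols ?D 1 v = v"
      by (auto simp: scale_rows_def scale_cols_def)
    then have total: "(?a + ?c) * (?a' + ?c') \<le> 1" using rows[of 1] cols[of 1] le by simp
    have "0 < ?a" using 3 u by (intro sum_pos2[of _ i0]) auto
    moreover have "0 < ?c'" using 3 v unconn by (intro sum_pos2[of _ j0]) auto
    moreover have "0 \<le> ?a'" "0 \<le> ?c" using u v by (auto intro: sum_nonneg)
    ultimately obtain t where t: "0 < t" "(t * ?a + ?c) * (?a' / t + ?c') = 1"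
      using unbalance_to_one total by metis
    have "scale_rows ?D t u i * scale_cols ?D t v j = M (i, j)" if "(i, j) \<in> S" for i j
      using scale_edge[OF connected_set_in_graph_components that] t(1) potentialsD[OF uv that] by simp
    moreover have "0 \<le> scale_rows ?D t u i" for i using t(1) u by (simp add: scale_rows_def)
    moreover have "0 \<le> scale_cols ?D t v j" for j using t(1) v by (simp add: scale_cols_def)
    ultimately show ?thesis
      using t(2) rows[of t] cols[of t]
      by (intro exI[of _ "scale_rows ?D t u"] exI[of _ "scale_cols ?D t v"])
        (auto simp: potentials_def)
  qed
qed

section \<open>Characterization of the completable partial matrices\<close>

lemma completable_iff_connected:
  fixes S :: "('m::finite \<times> 'n::finite) set"
  assumes UNIV: "UNIV \<in> graph_components S"
  shows "M \<in> rank_one_completable S \<longleftrightarrow>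
    M \<in> partial_matrices S \<and> all_cycle_relations S M \<and>
    block_sum S M (complete_bip UNIV) = 1 \<and> (\<forall>e\<in>S. 0 < M e)"
proof -
  have block: "block_sum S M (complete_bip UNIV) = (\<Sum>i\<in>UNIV. u i) * (\<Sum>j\<in>UNIV. v j)"
    if "\<forall>e\<in>S. 0 < M e" "potentials S M u v" for u v
    using block_sum_eq[OF that(2) _ UNIV] that(1) by force
  show ?thesis
  proof
    assume "M \<in> rank_one_completable S"
    then obtain u v where M: "M \<in> partial_matrices S" "\<forall>e\<in>S. 0 < M e"
      and uv: "potentials S M u v"
      and "(\<Sum>i\<in>UNIV. u i) * (\<Sum>j\<in>UNIV. v j) = 1"
      unfolding rank_one_completable_iff by auto
    then show "M \<in> partial_matrices S \<and> all_cycle_relations S M \<and>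
        block_sum S M (complete_bip UNIV) = 1 \<and> (\<forall>e\<in>S. 0 < M e)"
      using block[OF M(2) uv] potentials_imp_cycle_relations[OF uv] by auto
  next
    assume R: "M \<in> partial_matrices S \<and> all_cycle_relations S M \<and>
        block_sum S M (complete_bip UNIV) = 1 \<and> (\<forall>e\<in>S. 0 < M e)"
    then obtain u v where "\<forall>i. 0 < u i" "\<forall>j. 0 < v j"
      and uv: "potentials S M u v"
      using potentials_exist[of S M] by blast
    then show "M \<in> rank_one_completable S"
      unfolding rank_one_completable_iff using R block[OF _ uv]
      by (auto simp: less_imp_le intro!: exI[of _ u] exI[of _ v])
  qed
qed

lemma completable_iff_disconnected:
  fixes S :: "('m::finite \<times> 'n::finite) set"
  assumes "graph_closure S \<noteq> UNIV"
  shows "M \<in> rank_one_completable S \<longleftrightarrow>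
    M \<in> partial_matrices S \<and> all_cycle_relations S M \<and> (\<forall>e\<in>S. 0 < M e) \<and>
    (\<Sum>D\<in>graph_components S. sqrt (block_sum S M (complete_bip D))) \<le> 1"
proof
  assume "M \<in> rank_one_completable S"
  then obtain u v where M: "M \<in> partial_matrices S" "\<forall>e\<in>S. 0 < M e"
    and nonneg: "\<And>i. 0 \<le> u i" "\<And>j. 0 \<le> v j"
    and uv: "potentials S M u v"
    and total: "(\<Sum>i\<in>UNIV. u i) * (\<Sum>j\<in>UNIV. v j) = 1"
    unfolding rank_one_completable_iff by auto
  have "\<forall>e\<in>S. M e \<noteq> 0" using M(2) by force
  then have "(\<Sum>D\<in>graph_components S. sqrt (block_sum S M (complete_bip D))) \<le> sqrt 1"
    using sum_sqrt_blocks_le[OF uv _ nonneg] total by metis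
  then show "M \<in> partial_matrices S \<and> all_cycle_relations S M \<and> (\<forall>e\<in>S. 0 < M e) \<and>
      (\<Sum>D\<in>graph_components S. sqrt (block_sum S M (complete_bip D))) \<le> 1"
    using M potentials_imp_cycle_relations[OF uv] by simp
next
  let ?T = "\<Sum>D\<in>graph_components S. sqrt (block_sum S M (complete_bip D))"
  assume R: "M \<in> partial_matrices S \<and> all_cycle_relations S M \<and> (\<forall>e\<in>S. 0 < M e) \<and> ?T \<le> 1"
  then obtain u v where nonneg: "\<And>i. 0 \<le> u i" "\<And>j. 0 \<le> v j"
    and uv: "potentials S M u v"
    and sums: "(\<Sum>i\<in>UNIV. u i) = ?T" "(\<Sum>j\<in>UNIV. v j) = ?T"
    using balanced_potentials[of S M] by metis
  have "0 \<le> ?T" using sums(1) nonneg(1) by (metis sum_nonneg)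
  then have "(\<Sum>i\<in>UNIV. u i) * (\<Sum>j\<in>UNIV. v j) \<le> 1" using R sums by (simp add: mult_le_one)
  moreover obtain i0 j0 where "(Inl i0, Inr j0) \<notin> (bip_adj S)\<^sup>*"
    using assms graph_closure_iff[of _ _ S] by auto
  ultimately show "M \<in> rank_one_completable S"
    unfolding rank_one_completable_iff
    using R raise_total_to_one[of S M u v] nonneg uv by metis
qed

lemma edge_components_connected:
  fixes S :: "('m \<times> 'n) set"
  assumes "graph_closure S = UNIV"
  shows "edge_components S = {UNIV}" "UNIV \<in> graph_components S"
proof -
  have lr: "(Inl i, Inr j) \<in> (bip_adj S)\<^sup>*" for i j using assms graph_closure_iff[of i j S] by auto
  have same: "D = UNIV" if D: "D \<in> graph_components S" for D
  proof -
    obtain w where w: "w \<in> D"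
      using D in_quotient_imp_non_empty[OF equiv_bip_adj_rtrancl] unfolding graph_components_def by blast
    have iff: "Inl i \<in> D \<longleftrightarrow> Inr j \<in> D" for i j
      using lr[of i j] connected_iff_same_component[OF D] equiv_bip_adj_rtrancl[of S]
      by (meson equivE symD)
    have "z \<in> D" for z using w iff by (cases w; cases z) metis+
    then show ?thesis by blast
  qed
  show U: "UNIV \<in> graph_components S"
    using same connected_set_in_graph_components by metis
  have "UNIV \<in> edge_components S"
    using complete_bip_empty[OF U] by (auto simp: complete_bip_def)
  then show "edge_components S = {UNIV}" using same by (auto simp: edge_components_def)
qed

theorem theorem2p12:
  fixes S :: "('m::finite \<times> 'n::finite) set"
    and s :: nat
    and C :: "nat \<Rightarrow> ('m + 'n) set"
    and K :: "nat \<Rightarrow> ('m \<times> 'n) set"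
    and b :: "('m \<times> 'n \<Rightarrow> real) \<Rightarrow> nat \<Rightarrow> real"
  assumes "s = card (edge_components S)"
    and "bij_betw C {1..s} (edge_components S)"
    and "\<And>l. l \<in> {1..s} \<Longrightarrow> K l = complete_bip (C l)"
    and "\<And>M l. l \<in> {1..s} \<Longrightarrow> b M l = block_sum S M (K l)"
  shows "(graph_closure S = UNIV \<longrightarrow>
            rank_one_completable S =
              {M \<in> partial_matrices S.
                 all_cycle_relations S M \<and> b M 1 = 1 \<and> (\<forall>e\<in>S. 0 < M e)}) \<and>
         (graph_closure S \<noteq> UNIV \<longrightarrow>
            rank_one_completable S =
              {M \<in> partial_matrices S.
                 all_cycle_relations S M \<and> (\<forall>e\<in>S. 0 < M e) \<and>
                 (\<Sum>l=1..s. sqrt (b M l)) \<le> 1})"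
proof (intro conjI impI)
  assume conn: "graph_closure S = UNIV"
  note comps = edge_components_connected[OF conn]
  have "s = 1" using assms(1) comps(1) by simp
  then have "C 1 = UNIV" using assms(2) comps(1) by (auto simp: bij_betw_def)
  then have "b M 1 = block_sum S M (complete_bip UNIV)" for M
    using assms(3,4)[of 1] \<open>s = 1\<close> by simp
  then show "rank_one_completable S =
      {M \<in> partial_matrices S. all_cycle_relations S M \<and> b M 1 = 1 \<and> (\<forall>e\<in>S. 0 < M e)}"
    using completable_iff_connected[OF comps(2)] by auto
next
  assume disconn: "graph_closure S \<noteq> UNIV"
  have "(\<Sum>l=1..s. sqrt (b M l)) =
      (\<Sum>D\<in>graph_components S. sqrt (block_sum S M (complete_bip D)))" for M
  proof -
    have "(\<Sum>l=1..s. sqrt (b M l)) = (\<Sum>l=1..s. sqrt (block_sum S M (complete_bip (C l))))"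
      using assms(3,4) by (intro sum.cong) auto
    also have "\<dots> = (\<Sum>D\<in>edge_components S. sqrt (block_sum S M (complete_bip D)))"
      using assms(2) by (rule sum.reindex_bij_betw)
    also have "\<dots> = (\<Sum>D\<in>graph_components S. sqrt (block_sum S M (complete_bip D)))"
      using complete_bip_empty[of _ S]
      by (intro sum.mono_neutral_left) (auto simp: edge_components_def block_sum_def)
    finally show ?thesis .
  qed
  then show "rank_one_completable S =
      {M \<in> partial_matrices S. all_cycle_relations S M \<and> (\<forall>e\<in>S. 0 < M e) \<and>
         (\<Sum>l=1..s. sqrt (b M l)) \<le> 1}"
    using completable_iff_disconnected[OF disconn] by auto
qed

end
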